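(* Let $\mathfrak{q}=(x_1^{a_1}, \ldots ,x_n^{a_n}) \subset S=\mathbb{K}[x_1,\ldots,x_n]$ be an irreducible monomial ideal with $a_i >0$ for $i= 1, \ldots, n$. Let $i_0 \in \{1, \ldots, n\}$ be such that $a_{i_0} =\max\{a_1, \ldots, a_n\}$, and for every integer $k\geq 1$ let $t_k=ka_{i_0} + \sum_{i \neq i_0} a_i-n+1$. Then for all $k\geq 1$: (a) $\mathfrak{q}^k\colon\mathfrak{m}^{t_k-1}=\mathfrak{m}$; (b) $\mathrm{sat}(\mathfrak{q}^k)=t_k$.
   Context: $\mathbb{K}$ is a field, $S=\mathbb{K}[x_1,\ldots,x_n]$ is the polynomial ring ($n\ge 1$) and $\mathfrak{m}=(x_1,\ldots,x_n)$. For ideals $I,J$ of $S$, $I\colon J=\{f\in S : fJ\subseteq I\}$, and $\mathfrak{m}^0=S$. The saturation number of an ideal $I\subset S$ is $\mathrm{sat}(I)=\min\{k\geq 0 : I\colon\mathfrak{m}^k=I\colon\mathfrak{m}^{k+1}\}$. *)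

theory Defs
  imports Complex_Main "HOL-Library.Poly_Mapping" "HOL-Library.Cardinality"
begin

text \<open>
  Polynomials over \<open>'k\<close> with one variable for each element of \<open>'n\<close>: finitely supported
  functions from exponent vectors to coefficients, with the convolution product of
  \<^theory>\<open>HOL-Library.Poly_Mapping\<close>. For \<open>'n\<close> finite and \<open>'k\<close> a field this is
  \<open>S = K[x_1, ..., x_n]\<close> with \<open>n = CARD('n)\<close>, which is at least 1.
\<close>

type_synonym ('n, 'k) mpoly = "('n \<Rightarrow>\<^sub>0 nat) \<Rightarrow>\<^sub>0 'k"

definition Var :: "'n \<Rightarrow> ('n, 'k::field) mpoly"
  where "Var i = Poly_Mapping.single (Poly_Mapping.single i 1) 1"

text \<open>Ideals of a commutative ring are its submodules when it acts on itself by multiplication.\<close>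

lemma module_times: "module ((*) :: 'a::comm_ring_1 \<Rightarrow> 'a \<Rightarrow> 'a)"
  by unfold_locales (simp_all add: algebra_simps)

definition ideal_gen :: "'a::comm_ring_1 set \<Rightarrow> 'a set"
  where "ideal_gen B = module.span (*) B"

definition ideal_mult :: "'a::comm_ring_1 set \<Rightarrow> 'a set \<Rightarrow> 'a set"
  where "ideal_mult I J = ideal_gen {f * g | f g. f \<in> I \<and> g \<in> J}"

primrec ideal_power :: "'a::comm_ring_1 set \<Rightarrow> nat \<Rightarrow> 'a set"
  where
    "ideal_power I 0 = UNIV"
  | "ideal_power I (Suc k) = ideal_mult I (ideal_power I k)"

definition ideal_colon :: "'a::comm_ring_1 set \<Rightarrow> 'a set \<Rightarrow> 'a set"
  where "ideal_colon I J = {f. \<forall>g\<in>J. f * g \<in> I}"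

definition max_ideal :: "('n::finite, 'k::field) mpoly set"
  where "max_ideal = ideal_gen (range Var)"

text \<open>The ring is Noetherian, so for an ideal \<open>I\<close> the set minimised over is nonempty.\<close>

definition sat :: "('n::finite, 'k::field) mpoly set \<Rightarrow> nat"
  where "sat I = (LEAST k. ideal_colon I (ideal_power max_ideal k)
                         = ideal_colon I (ideal_power max_ideal (k + 1)))"

definition pure_power_ideal :: "('n::finite \<Rightarrow> nat) \<Rightarrow> ('n, 'k::field) mpoly set"
  where "pure_power_ideal a = ideal_gen {Var i ^ a i | i. True}"

text \<open>
  Integer-valued, so that the subtraction of \<open>n\<close> is not truncated; the value is positive when
  \<open>k\<close> and all \<open>a i\<close> are.
\<close>

definition sat_value :: "('n::finite \<Rightarrow> nat) \<Rightarrow> 'n \<Rightarrow> nat \<Rightarrow> int"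
  where "sat_value a i0 k =
    int k * int (a i0) + (\<Sum>i\<in>UNIV - {i0}. int (a i)) - int CARD('n) + 1"

end

theory Submission
  imports Defs
begin

text \<open>
  Write \<open>d\<^sub>a(u) = \<Sum>\<^sub>i \<lfloor>u\<^sub>i / a\<^sub>i\<rfloor>\<close> for an exponent vector \<open>u\<close>. A polynomial lies in \<open>q\<^sup>k\<close> iff all
  its monomials \<open>x\<^sup>u\<close> satisfy \<open>d\<^sub>a(u) \<ge> k\<close>, and \<open>\<mm>\<close> is the case \<open>a = 1\<close>, where \<open>d\<^sub>a\<close> is the total
  degree. Hence \<open>x\<^sup>u\<close> lies in \<open>q\<^sup>k : \<mm>\<^sup>j\<close> iff \<open>d\<^sub>a(u + v) \<ge> k\<close> for all \<open>v\<close> of degree at least \<open>j\<close>.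
  The largest degree of a monomial outside \<open>q\<^sup>k\<close> is \<open>t\<^sub>k - 1\<close>, attained by \<open>w\<close> with
  \<open>w\<^sub>i = a\<^sub>i - 1\<close> for \<open>i \<noteq> i\<^sub>0\<close> and \<open>w\<^sub>i = k a\<^sub>i - 1\<close> for \<open>i = i\<^sub>0\<close>. So the colon ideal is everything
  for \<open>j \<ge> t\<^sub>k\<close> and \<open>\<mm>\<close> for \<open>j = t\<^sub>k - 1\<close>, and for \<open>j < t\<^sub>k\<close> a divisor of \<open>x\<^sup>w\<close> of degree
  \<open>t\<^sub>k - 1 - j\<close> lies in \<open>q\<^sup>k : \<mm>\<^sup>j\<^sup>+\<^sup>1\<close> but not in \<open>q\<^sup>k : \<mm>\<^sup>j\<close>.
\<close>

section \<open>Ideals spanned by monomials\<close>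

text \<open>For arbitrary \<open>U\<close> this is only a linear subspace. It is an ideal once
  \<open>U\<close> is \<open>up_closed\<close>, that is, stable under multiplying monomials by
  monomials.\<close>

definition monomial_ideal :: "('n \<Rightarrow>\<^sub>0 nat) set \<Rightarrow> ('n, 'k::field) mpoly set"
  where "monomial_ideal U = {f. Poly_Mapping.keys f \<subseteq> U}"

definition up_closed :: "('n \<Rightarrow>\<^sub>0 nat) set \<Rightarrow> bool"
  where "up_closed U \<longleftrightarrow> (\<forall>u\<in>U. \<forall>v. u + v \<in> U)"

lemma poly_mapping_sum_single:
  fixes f :: "'a \<Rightarrow>\<^sub>0 'b::comm_monoid_add"
  shows "f = (\<Sum>u\<in>Poly_Mapping.keys f. Poly_Mapping.single u (Poly_Mapping.lookup f u))"
  by (rule poly_mapping_eqI)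
    (simp add: lookup_sum lookup_single when_def sum.delta in_keys_iff)

text \<open>Multiplication by a monomial shifts exponents injectively, so no terms cancel.\<close>

lemma lookup_times_single_one:
  fixes f :: "('n, 'k::field) mpoly"
  shows "Poly_Mapping.lookup (f * Poly_Mapping.single v 1) (u + v) = Poly_Mapping.lookup f u"
proof -
  have "f * Poly_Mapping.single v 1
      = (\<Sum>w\<in>Poly_Mapping.keys f. Poly_Mapping.single (w + v) (Poly_Mapping.lookup f w))"
    by (subst poly_mapping_sum_single[of f]) (simp add: sum_distrib_right mult_single)
  then show ?thesis
    by (simp add: lookup_sum lookup_single when_def sum.delta in_keys_iff)
qed

lemma single_mem_monomial_ideal_iff:
  "(Poly_Mapping.single u 1 :: ('n, 'k::field) mpoly) \<in> monomial_ideal U \<longleftrightarrow> u \<in> U"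
  by (simp add: monomial_ideal_def)

lemma subspace_monomial_ideal:
  assumes "up_closed U"
  shows "module.subspace (*) (monomial_ideal U :: ('n, 'k::field) mpoly set)"
proof -
  have "c * f \<in> monomial_ideal U" if "f \<in> monomial_ideal U" for c f :: "('n, 'k) mpoly"
    using that assms keys_mult[of c f]
    by (fastforce simp: monomial_ideal_def up_closed_def add.commute)
  moreover have "f + g \<in> monomial_ideal U"
    if "f \<in> monomial_ideal U" "g \<in> monomial_ideal U" for f g :: "('n, 'k) mpoly"
    using that Poly_Mapping.keys_add[of f g] by (auto simp: monomial_ideal_def)
  moreover have "(0 :: ('n, 'k) mpoly) \<in> monomial_ideal U"
    by (simp add: monomial_ideal_def)
  ultimately show ?thesis
    unfolding module.subspace_def[OF module_times] by blast
qed

lemma monomial_ideal_subset_ideal_gen: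
  fixes B :: "('n, 'k::field) mpoly set"
  assumes "\<And>u. u \<in> U \<Longrightarrow> Poly_Mapping.single u 1 \<in> ideal_gen B"
  shows "monomial_ideal U \<subseteq> ideal_gen B"
proof
  fix f :: "('n, 'k) mpoly"
  assume f: "f \<in> monomial_ideal U"
  have "Poly_Mapping.single u (Poly_Mapping.lookup f u) \<in> ideal_gen B"
    if "u \<in> Poly_Mapping.keys f" for u
  proof -
    have "Poly_Mapping.single u (Poly_Mapping.lookup f u)
        = Poly_Mapping.single 0 (Poly_Mapping.lookup f u) * Poly_Mapping.single u (1 :: 'k)"
      by (simp add: mult_single)
    moreover have "Poly_Mapping.single u 1 \<in> ideal_gen B"
      using assms that f by (auto simp: monomial_ideal_def)
    ultimately show ?thesis
      unfolding ideal_gen_def by (simp add: module.span_scale[OF module_times])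
  qed
  then have "(\<Sum>u\<in>Poly_Mapping.keys f. Poly_Mapping.single u (Poly_Mapping.lookup f u)) \<in> ideal_gen B"
    unfolding ideal_gen_def by (intro module.span_sum[OF module_times])
  then show "f \<in> ideal_gen B"
    by (simp flip: poly_mapping_sum_single)
qed

lemma ideal_gen_subset_monomial_ideal:
  fixes B :: "('n, 'k::field) mpoly set"
  assumes "up_closed U" "B \<subseteq> monomial_ideal U"
  shows "ideal_gen B \<subseteq> monomial_ideal U"
  unfolding ideal_gen_def
  using assms by (intro module.span_minimal[OF module_times] subspace_monomial_ideal)

text \<open>The exponents of \<open>f * g\<close> are sums of exponents of \<open>f\<close> and
  \<open>g\<close>; conversely each monomial with exponent \<open>u + v\<close> is itself a product
  of two members.\<close>

lemma ideal_mult_monomial_ideal: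
  assumes "up_closed {u + v | u v. u \<in> U \<and> v \<in> V}"
  shows "ideal_mult (monomial_ideal U) (monomial_ideal V)
    = (monomial_ideal {u + v | u v. u \<in> U \<and> v \<in> V} :: ('n, 'k::field) mpoly set)"
    (is "?L = monomial_ideal ?W")
proof
  have "f * g \<in> monomial_ideal ?W"
    if "f \<in> monomial_ideal U" "g \<in> monomial_ideal V" for f g :: "('n, 'k) mpoly"
  proof -
    have "{u + v | u v. u \<in> Poly_Mapping.keys f \<and> v \<in> Poly_Mapping.keys g} \<subseteq> ?W"
      using that by (auto simp: monomial_ideal_def)
    then show ?thesis
      using keys_mult[of f g] by (simp add: monomial_ideal_def)
  qed
  then show "?L \<subseteq> monomial_ideal ?W"
    unfolding ideal_mult_def using assms by (intro ideal_gen_subset_monomial_ideal) auto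
  have "(Poly_Mapping.single (u + v) 1 :: ('n, 'k) mpoly) \<in> ?L" if "u \<in> U" "v \<in> V" for u v
  proof -
    have "(Poly_Mapping.single (u + v) 1 :: ('n, 'k) mpoly)
        = Poly_Mapping.single u 1 * Poly_Mapping.single v 1"
      by (simp add: mult_single)
    with that have "(Poly_Mapping.single (u + v) 1 :: ('n, 'k) mpoly)
        \<in> {f * g | f g. f \<in> monomial_ideal U \<and> g \<in> monomial_ideal V}"
      unfolding mem_Collect_eq by (metis single_mem_monomial_ideal_iff)
    then show ?thesis
      unfolding ideal_mult_def ideal_gen_def by (rule module.span_base[OF module_times])
  qed
  then show "monomial_ideal ?W \<subseteq> ?L"
    unfolding ideal_mult_def by (intro monomial_ideal_subset_ideal_gen) auto
qed

text \<open>Testing \<open>f\<close> against single monomials suffices, because such products keep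
  every shifted exponent of \<open>f\<close>.\<close>

lemma ideal_colon_monomial_ideal:
  "ideal_colon (monomial_ideal U) (monomial_ideal V)
    = (monomial_ideal {u. \<forall>v\<in>V. u + v \<in> U} :: ('n, 'k::field) mpoly set)"
proof (intro equalityI subsetI)
  fix f :: "('n, 'k) mpoly"
  assume f: "f \<in> ideal_colon (monomial_ideal U) (monomial_ideal V)"
  have "u + v \<in> U" if "u \<in> Poly_Mapping.keys f" "v \<in> V" for u v
  proof -
    have "f * Poly_Mapping.single v 1 \<in> monomial_ideal U"
      using f that by (simp add: ideal_colon_def single_mem_monomial_ideal_iff)
    moreover have "u + v \<in> Poly_Mapping.keys (f * Poly_Mapping.single v 1)"
      using that by (simp add: in_keys_iff lookup_times_single_one)
    ultimately show ?thesis
      by (auto simp: monomial_ideal_def)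
  qed
  then show "f \<in> monomial_ideal {u. \<forall>v\<in>V. u + v \<in> U}"
    by (auto simp: monomial_ideal_def)
next
  fix f :: "('n, 'k) mpoly"
  assume f: "f \<in> monomial_ideal {u. \<forall>v\<in>V. u + v \<in> U}"
  have "f * g \<in> monomial_ideal U" if "g \<in> monomial_ideal V" for g
  proof -
    have "{u + v | u v. u \<in> Poly_Mapping.keys f \<and> v \<in> Poly_Mapping.keys g} \<subseteq> U"
      using f that by (auto simp: monomial_ideal_def)
    then show ?thesis
      using keys_mult[of f g] by (simp add: monomial_ideal_def)
  qed
  then show "f \<in> ideal_colon (monomial_ideal U) (monomial_ideal V)"
    by (simp add: ideal_colon_def)
qed

section \<open>Powers of an irreducible monomial ideal\<close>

text \<open>For positive \<open>a\<close>, the largest number of generators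
  \<open>Var i ^ a i\<close>, counted with repetition, whose product divides the monomial.\<close>

definition weighted_degree :: "('n::finite \<Rightarrow> nat) \<Rightarrow> ('n \<Rightarrow>\<^sub>0 nat) \<Rightarrow> nat"
  where "weighted_degree a u = (\<Sum>i\<in>UNIV. Poly_Mapping.lookup u i div a i)"

abbreviation total_degree :: "('n::finite \<Rightarrow>\<^sub>0 nat) \<Rightarrow> nat"
  where "total_degree \<equiv> weighted_degree (\<lambda>_. Suc 0)"

lemma total_degree_eq: "total_degree u = (\<Sum>i\<in>UNIV. Poly_Mapping.lookup u i)"
  by (simp add: weighted_degree_def)

lemma total_degree_add: "total_degree (u + v) = total_degree u + total_degree v"
  by (simp add: total_degree_eq lookup_add sum.distrib)

text \<open>Quotients add up, and the sum of the two remainders can only contribute a further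
  carry.\<close>

lemma weighted_degree_superadditive:
  "weighted_degree a u + weighted_degree a v \<le> weighted_degree a (u + v)"
  unfolding weighted_degree_def sum.distrib[symmetric]
  by (intro sum_mono) (subst lookup_add, subst div_add1_eq, simp)

lemma weighted_degree_single_add:
  assumes "a i > 0"
  shows "weighted_degree a (Poly_Mapping.single i (a i) + u) = Suc (weighted_degree a u)"
proof -
  have "weighted_degree a (Poly_Mapping.single i (a i) + u)
      = (\<Sum>j\<in>UNIV. (if j = i then 1 else 0) + Poly_Mapping.lookup u j div a j)"
    unfolding weighted_degree_def using assms
    by (intro sum.cong) (auto simp: lookup_add lookup_single when_def)
  then show ?thesis
    by (simp add: sum.distrib weighted_degree_def)
qed

lemma weighted_degree_pos_decompose:
  assumes "weighted_degree a u > 0"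
  obtains i v where "u = Poly_Mapping.single i (a i) + v"
proof -
  obtain i where "Poly_Mapping.lookup u i div a i \<noteq> 0"
    using assms unfolding weighted_degree_def
    by (metis less_irrefl sum.not_neutral_contains_not_neutral)
  then have "a i \<le> Poly_Mapping.lookup u i"
    by (meson div_less not_le)
  then have "u = Poly_Mapping.single i (a i) + (u - Poly_Mapping.single i (a i))"
    by (intro poly_mapping_eqI) (auto simp: lookup_add lookup_minus lookup_single when_def)
  then show ?thesis
    by (rule that)
qed

lemma up_closed_weighted_degree: "up_closed {u. k \<le> weighted_degree a u}"
  unfolding up_closed_def
proof clarify
  fix u v
  assume "k \<le> weighted_degree a u"
  then show "k \<le> weighted_degree a (u + v)"
    using weighted_degree_superadditive[of a u v] by linarith
qed

lemma Var_power: "(Var i :: ('n, 'k::field) mpoly) ^ m = Poly_Mapping.single (Poly_Mapping.single i m) 1"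
  by (induction m) (simp_all add: Var_def mult_single flip: single_add)

lemma pure_power_ideal_eq:
  fixes a :: "'n::finite \<Rightarrow> nat"
  assumes "\<And>i. a i > 0"
  shows "pure_power_ideal a = (monomial_ideal {u. 1 \<le> weighted_degree a u} :: ('n, 'k::field) mpoly set)"
    (is "_ = monomial_ideal ?U")
proof
  have "(Var i :: ('n, 'k) mpoly) ^ a i \<in> monomial_ideal ?U" for i
    using weighted_degree_single_add[of a i 0] assms
    by (simp add: Var_power single_mem_monomial_ideal_iff)
  then show "pure_power_ideal a \<subseteq> (monomial_ideal ?U :: ('n, 'k) mpoly set)"
    unfolding pure_power_ideal_def
    by (intro ideal_gen_subset_monomial_ideal up_closed_weighted_degree) auto
  have "(Poly_Mapping.single u 1 :: ('n, 'k) mpoly) \<in> pure_power_ideal a" if u: "u \<in> ?U" for u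
  proof -
    obtain i v where "u = Poly_Mapping.single i (a i) + v"
      using weighted_degree_pos_decompose[of a u] u by auto
    then have "Poly_Mapping.single u 1 = Poly_Mapping.single v 1 * (Var i :: ('n, 'k) mpoly) ^ a i"
      by (simp add: Var_power mult_single add.commute)
    then show ?thesis
      unfolding pure_power_ideal_def ideal_gen_def
      by (auto intro: module.span_scale[OF module_times] module.span_base[OF module_times])
  qed
  then show "(monomial_ideal ?U :: ('n, 'k) mpoly set) \<subseteq> pure_power_ideal a"
    unfolding pure_power_ideal_def by (intro monomial_ideal_subset_ideal_gen)
qed

text \<open>Splitting off one generator lowers the degree by exactly one; this drives the induction
  on the power of the ideal.\<close>

lemma weighted_degree_sumset:
  assumes "\<And>i. a i > 0"
  shows "{u + v | u v. u \<in> {u. 1 \<le> weighted_degree a u} \<and> v \<in> {v. k \<le> weighted_degree a v}}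
    = {w. Suc k \<le> weighted_degree a w}"
    (is "?L = ?R")
proof (intro equalityI subsetI)
  fix w assume "w \<in> ?L"
  then obtain u v where "w = u + v" "1 \<le> weighted_degree a u" "k \<le> weighted_degree a v"
    by auto
  then show "w \<in> ?R"
    using weighted_degree_superadditive[of a u v] by simp
next
  fix w assume w: "w \<in> ?R"
  then obtain i v where w': "w = Poly_Mapping.single i (a i) + v"
    using weighted_degree_pos_decompose[of a w] by auto
  then have "k \<le> weighted_degree a v"
    using w weighted_degree_single_add[of a i v] assms by simp
  moreover have "1 \<le> weighted_degree a (Poly_Mapping.single i (a i))"
    using weighted_degree_single_add[of a i 0] assms by simp
  ultimately show "w \<in> ?L"
    using w' by blast
qed

lemma pure_power_ideal_power:
  fixes a :: "'n::finite \<Rightarrow> nat"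
  assumes "\<And>i. a i > 0"
  shows "ideal_power (pure_power_ideal a) k
    = (monomial_ideal {u. k \<le> weighted_degree a u} :: ('n, 'k::field) mpoly set)"
proof (induction k)
  case 0
  show ?case
    by (simp add: monomial_ideal_def)
next
  case (Suc k)
  then show ?case
    using ideal_mult_monomial_ideal
      [of "{u. 1 \<le> weighted_degree a u}" "{u. k \<le> weighted_degree a u}"]
    unfolding weighted_degree_sumset[of a, OF assms] pure_power_ideal_eq[of a, OF assms]
    by (simp add: up_closed_weighted_degree)
qed

lemma max_ideal_eq_pure_power_ideal:
  "max_ideal = (pure_power_ideal (\<lambda>_. Suc 0) :: ('n::finite, 'k::field) mpoly set)"
  unfolding max_ideal_def pure_power_ideal_def by (simp add: full_SetCompr_eq)

section \<open>The saturation number\<close>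

text \<open>Divide each exponent by \<open>a i\<close>: the remainder is at most
  \<open>a i - 1\<close>, and the factor \<open>a i\<close> of the quotient is at most
  \<open>m\<close>.\<close>

lemma total_degree_bound:
  assumes "\<And>i. a i > 0" "\<And>i. a i \<le> m"
  shows "total_degree u \<le> m * weighted_degree a u + (\<Sum>i\<in>UNIV. a i - 1)"
proof -
  have "Poly_Mapping.lookup u i \<le> m * (Poly_Mapping.lookup u i div a i) + (a i - 1)" for i
  proof -
    have "Poly_Mapping.lookup u i = a i * (Poly_Mapping.lookup u i div a i) + Poly_Mapping.lookup u i mod a i"
      by simp
    moreover have "Poly_Mapping.lookup u i mod a i < a i"
      using assms(1) by simp
    moreover have "a i * (Poly_Mapping.lookup u i div a i) \<le> m * (Poly_Mapping.lookup u i div a i)"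
      using assms(2) by simp
    ultimately show ?thesis
      by linarith
  qed
  then show ?thesis
    unfolding total_degree_eq weighted_degree_def sum_distrib_left sum.distrib[symmetric]
    by (intro sum_mono) simp
qed

lemma exists_maximal_degree_witness:
  fixes a :: "'n::finite \<Rightarrow> nat"
  assumes "\<And>i. a i > 0"
  shows "\<exists>w. weighted_degree a w = k \<and> total_degree w = a i0 * k + (\<Sum>i\<in>UNIV. a i - 1)"
proof -
  \<comment> \<open>All remainders are maximal and the whole quotient sits at \<open>i0\<close>, so
    the bound above is attained when \<open>a i0\<close> is the maximum. Finite support is automatic
    over a finite index type.\<close>
  define w where "w = Abs_poly_mapping (\<lambda>i. (if i = i0 then a i * k else 0) + (a i - 1))"
  have w: "Poly_Mapping.lookup w i = (if i = i0 then a i * k else 0) + (a i - 1)" for i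
    by (simp add: w_def)
  have "(a i - 1) div a i = 0" for i
    using assms[of i] by simp
  then have "Poly_Mapping.lookup w i div a i = (if i = i0 then k else 0)" for i
    using assms[of i] by (cases "i = i0") (simp_all add: w del: add_diff_assoc)
  then have "weighted_degree a w = k"
    by (simp add: weighted_degree_def)
  moreover have "total_degree w = a i0 * k + (\<Sum>i\<in>UNIV. a i - 1)"
    by (simp add: total_degree_eq w sum.distrib)
  ultimately show ?thesis
    by blast
qed

text \<open>Variables are moved one at a time from \<open>u\<close> to \<open>v\<close>.\<close>

lemma total_degree_split:
  fixes w :: "'n::finite \<Rightarrow>\<^sub>0 nat"
  assumes "d \<le> total_degree w"
  shows "\<exists>u v. w = u + v \<and> total_degree v = d"
  using assms
proof (induction d)
  case 0
  have "total_degree (0 :: 'n \<Rightarrow>\<^sub>0 nat) = 0"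
    by (simp add: total_degree_eq)
  then show ?case
    by (metis add_0_right)
next
  case (Suc d)
  then obtain u v where w: "w = u + v" and v: "total_degree v = d"
    by auto
  then have "total_degree u > 0"
    using Suc.prems by (simp add: total_degree_add)
  then obtain i u' where "u = Poly_Mapping.single i 1 + u'"
    using weighted_degree_pos_decompose[of "\<lambda>_. Suc 0" u] by auto
  then have "w = u' + (Poly_Mapping.single i 1 + v)"
    using w by (simp add: ac_simps)
  moreover have "total_degree (Poly_Mapping.single i 1 + v) = Suc d"
    using v weighted_degree_single_add[of "\<lambda>_. Suc 0" i v] by simp
  ultimately show ?case
    by blast
qed

theorem theorem2p1:
  fixes a :: "'n::finite \<Rightarrow> nat"
    and i0 :: 'n
    and q :: "('n, 'k::field) mpoly set"
  assumes "\<And>i. a i > 0"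
    and "a i0 = Max (range a)"
    and "q = pure_power_ideal a"
  shows "\<forall>k\<ge>1.
      ideal_colon (ideal_power q k) (ideal_power max_ideal (nat (sat_value a i0 k - 1))) = max_ideal
    \<and> int (sat (ideal_power q k)) = sat_value a i0 k"
proof (intro allI impI)
  fix k :: nat
  assume "k \<ge> 1"
  then obtain l where k: "k = Suc l"
    by (cases k) auto
  \<comment> \<open>\<open>T\<close> is \<open>sat_value a i0 k - 1\<close> as a natural number; no
    \<open>a i - 1\<close> truncates, since every \<open>a i\<close> is positive.\<close>
  define T where "T = a i0 * l + (\<Sum>i\<in>UNIV. a i - 1)"
  have "(\<Sum>i\<in>UNIV. int (a i)) = int (a i0) + (\<Sum>i\<in>UNIV - {i0}. int (a i))"
    by (simp add: sum.remove)
  moreover have "int (\<Sum>i\<in>UNIV. a i - 1) = (\<Sum>i\<in>UNIV. int (a i) - 1)"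
    unfolding of_nat_sum using assms(1)
    by (intro sum.cong) (auto simp: of_nat_diff Suc_le_eq)
  ultimately have t: "sat_value a i0 k = int T + 1"
    by (simp add: sat_value_def T_def k sum_subtractf algebra_simps)
  have large: "k \<le> weighted_degree a u" if "T < total_degree u" for u
  proof (rule ccontr)
    assume "\<not> k \<le> weighted_degree a u"
    then have "a i0 * weighted_degree a u \<le> a i0 * l"
      using k by simp
    moreover have "total_degree u \<le> a i0 * weighted_degree a u + (\<Sum>i\<in>UNIV. a i - 1)"
      using assms(1,2) by (intro total_degree_bound) auto
    ultimately show False
      using that unfolding T_def by linarith
  qed
  obtain w where w: "weighted_degree a w = l" "total_degree w = T"
    using exists_maximal_degree_witness[of a l i0] assms(1) by (auto simp: T_def)
  \<comment> \<open>The exponents of the monomials in the colon of the \<open>k\<close>-th power of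
    \<open>q\<close> by the \<open>j\<close>-th power of \<open>max_ideal\<close>.\<close>
  define C where "C j = {u. \<forall>v\<in>{v. j \<le> total_degree v}. u + v \<in> {u. k \<le> weighted_degree a u}}" for j
  have colon: "ideal_colon (ideal_power q k) (ideal_power max_ideal j) = monomial_ideal (C j)" for j
    using assms(1) unfolding C_def
    by (simp only: assms(3) max_ideal_eq_pure_power_ideal pure_power_ideal_power zero_less_Suc
        ideal_colon_monomial_ideal)
  have C_T: "C T = {u. 1 \<le> total_degree u}"
  proof (intro equalityI subsetI)
    fix u assume u: "u \<in> C T"
    \<comment> \<open>\<open>w\<close> has total degree \<open>T\<close> but weighted degree
      \<open>l < k\<close>, so it excludes the constant monomial.\<close>
    have "u \<noteq> 0"
      using u w k by (auto simp: C_def)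
    then obtain i where "Poly_Mapping.lookup u i \<noteq> 0"
      by (metis lookup_zero poly_mapping_eqI)
    then show "u \<in> {u. 1 \<le> total_degree u}"
      by (auto simp: total_degree_eq Suc_le_eq intro: ccontr)
  next
    fix u :: "'n \<Rightarrow>\<^sub>0 nat"
    assume "u \<in> {u. 1 \<le> total_degree u}"
    then show "u \<in> C T"
      by (auto simp: C_def total_degree_add intro!: large)
  qed
  have stable: "C j = UNIV" if "T < j" for j
    using that by (auto simp: C_def total_degree_add intro!: large)
  have strict: "C j \<noteq> C (j + 1)" if "j \<le> T" for j
  proof -
    \<comment> \<open>The factor \<open>v\<close> of degree \<open>j\<close> takes \<open>u\<close>
      to \<open>w\<close>, outside the power of \<open>q\<close>; any factor of degree above
      \<open>j\<close> takes \<open>u\<close> past total degree \<open>T\<close>, where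
      \<open>large\<close> applies.\<close>
    obtain u v where uv: "w = u + v" "total_degree v = j"
      using total_degree_split[of j w] w \<open>j \<le> T\<close> by auto
    then have "u \<notin> C j"
      using w k by (auto simp: C_def)
    moreover have "u \<in> C (j + 1)"
      using uv w by (auto simp: C_def total_degree_add intro!: large)
    ultimately show ?thesis
      by blast
  qed
  \<comment> \<open>Monomials recover the exponent set, so comparing the colon ideals reduces to
    comparing the sets \<open>C j\<close>.\<close>
  have inj: "U = V" if "(monomial_ideal U :: ('n, 'k) mpoly set) = monomial_ideal V" for U V
    using that single_mem_monomial_ideal_iff[where 'k = 'k] by (metis subsetI subset_antisym)
  have "sat (ideal_power q k) = T + 1"
    unfolding sat_def colon
  proof (rule Least_equality)
    show "monomial_ideal (C (T + 1)) = monomial_ideal (C (T + 1 + 1))"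
      by (simp add: stable)
    show "T + 1 \<le> j" if "monomial_ideal (C j) = (monomial_ideal (C (j + 1)) :: ('n, 'k) mpoly set)" for j
      using inj[OF that] strict[of j] by linarith
  qed
  moreover have "ideal_colon (ideal_power q k) (ideal_power max_ideal T) = max_ideal"
    unfolding colon C_T by (simp add: max_ideal_eq_pure_power_ideal pure_power_ideal_eq)
  ultimately show "ideal_colon (ideal_power q k) (ideal_power max_ideal (nat (sat_value a i0 k - 1))) = max_ideal
    \<and> int (sat (ideal_power q k)) = sat_value a i0 k"
    by (simp add: t)
qed

end
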